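(* The hyperbolic discrepancy density $\rho_{\mathbb{H}}$ and the tight hyperbolic discrepancy density $\rho_{\mathbb{H}}^*$ coincide: $$\rho_{\mathbb{H}}=\rho_{\mathbb{H}}^*.$$
   Context: Notation: $\mathbb{D}(0,r)=\{z\in\mathbb{C}:|z|<r\}$, $\mathbb{D}=\mathbb{D}(0,1)$, and $dA(z)=\frac{dx\,dy}{\pi}$ for $z=x+iy$. $\operatorname{Pol}(\mathbb{C})$ is the set of all complex polynomials in one variable. For $0<r<1$ and $f$ holomorphic on $\mathbb{D}$ put $$\Phi_f(z,r)=\left((1-|z|^2)|f(z)|-1_{\mathbb{D}(0,r)}(z)\right)^2,\qquad z\in\mathbb{D}.$$ For polynomials $f$ define $$\rho_{\mathbb{H},r}(f)=\frac{1}{\log\frac{1}{1-r^2}}\int_{\mathbb{D}(0,r)}\Phi_f(z,r)\frac{dA(z)}{1-|z|^2},\qquad \rho_{\mathbb{H},r}^*(f)=\frac{1}{\log\frac{1}{1-r^2}}\int_{\mathbb{D}}\Phi_f(z,r)\frac{dA(z)}{1-|z|^2},$$ (note $\int_{\mathbb{D}(0,r)}\frac{dA(z)}{1-|z|^2}=\log\frac1{1-r^2}$) and $$\rho_{\mathbb{H}}=\liminf_{r\to1^-}\inf_{f\in\operatorname{Pol}(\mathbb{C})}\rho_{\mathbb{H},r}(f),\qquad \rho_{\mathbb{H}}^*=\liminf_{r\to1^-}\inf_{f\in\operatorname{Pol}(\mathbb{C})}\rho_{\mathbb{H},r}^*(f).$$ *)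

theory Defs
  imports "HOL-Analysis.Analysis" "HOL-Computational_Algebra.Polynomial"
begin

text \<open>Normalised area measure \<open>dA = dx dy / \<pi>\<close> on the complex plane.\<close>

definition dA :: "complex measure" where
  "dA = density lborel (\<lambda>_. ennreal (1 / pi))"

definition Phi :: "(complex \<Rightarrow> complex) \<Rightarrow> complex \<Rightarrow> real \<Rightarrow> real" where
  "Phi f z r = ((1 - (cmod z)\<^sup>2) * cmod (f z) - indicator (ball 0 r) z)\<^sup>2"

definition rho_H_r :: "real \<Rightarrow> complex poly \<Rightarrow> real" where
  "rho_H_r r f = 1 / ln (1 / (1 - r\<^sup>2)) *
     (LINT z:ball 0 r|dA. Phi (poly f) z r / (1 - (cmod z)\<^sup>2))"

definition rho_H_star_r :: "real \<Rightarrow> complex poly \<Rightarrow> real" where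
  "rho_H_star_r r f = 1 / ln (1 / (1 - r\<^sup>2)) *
     (LINT z:ball 0 1|dA. Phi (poly f) z r / (1 - (cmod z)\<^sup>2))"

text \<open>The infimum and the lower limit are taken in the extended reals, where both always
  exist; only the values \<open>0 < r < 1\<close> matter for the filter \<open>at_left 1\<close>.\<close>

definition rho_H :: ereal where
  "rho_H = Liminf (at_left 1) (\<lambda>r. INF f. ereal (rho_H_r r f))"

definition rho_H_star :: ereal where
  "rho_H_star = Liminf (at_left 1) (\<lambda>r. INF f. ereal (rho_H_star_r r f))"

text \<open>A Bochner integral of a non-integrable function is \<open>0\<close> by convention; the next lemma
  shows that this never happens in the two definitions above.\<close>

lemma set_integrable_Phi:
  fixes f :: "complex poly"
  assumes r: "0 < r" "r < 1" and s: "s \<le> 1"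
  shows "set_integrable dA (ball 0 s) (\<lambda>z. Phi (poly f) z r / (1 - (cmod z)\<^sup>2))"
proof -
  have "continuous_on (cball 0 1) (poly f)"
    by (intro continuous_intros)
  then have "bounded (poly f ` cball 0 1)"
    by (intro compact_imp_bounded compact_continuous_image compact_cball)
  then obtain M where M: "cmod (poly f z) \<le> M" if "cmod z \<le> 1" for z
    unfolding bounded_iff by (metis imageI mem_cball_0)
  have M0: "0 \<le> M" using order_trans[OF norm_ge_zero M[of 0]] by simp
  have r2: "r\<^sup>2 < 1" using r by (simp add: power_less_one_iff)
  define B where "B = (M + 1)\<^sup>2 / (1 - r\<^sup>2) + M\<^sup>2"
  have bound: "\<bar>Phi (poly f) z r / (1 - (cmod z)\<^sup>2)\<bar> \<le> B" if z: "cmod z < 1" for z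
  proof -
    let ?t = "1 - (cmod z)\<^sup>2"
    have t: "0 < ?t" "?t \<le> 1" using z by (auto simp: power_less_one_iff)
    have m: "0 \<le> cmod (poly f z)" "cmod (poly f z) \<le> M" using M z by auto
    have tm: "0 \<le> ?t * cmod (poly f z)" "?t * cmod (poly f z) \<le> M"
      using t m mult_mono[of ?t 1 "cmod (poly f z)" M] by (auto intro: mult_nonneg_nonneg)
    show ?thesis
    proof (cases "cmod z < r")
      case True
      have "(cmod z)\<^sup>2 \<le> r\<^sup>2" using True by (intro power_mono) auto
      moreover have "Phi (poly f) z r \<le> (M + 1)\<^sup>2"
        unfolding Phi_def using tm M0 True by (intro abs_le_square_iff[THEN iffD1]) (auto simp: abs_le_iff)
      ultimately have "Phi (poly f) z r / ?t \<le> (M + 1)\<^sup>2 / (1 - r\<^sup>2)"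
        using r2 by (intro frac_le) auto
      then show ?thesis using t by (simp add: B_def Phi_def add_increasing2)
    next
      case False
      have "Phi (poly f) z r / ?t = ?t * (cmod (poly f z))\<^sup>2"
        using t False by (simp add: Phi_def power2_eq_square)
      also have "\<dots> \<le> 1 * M\<^sup>2"
        using t m by (intro mult_mono power_mono) auto
      finally show ?thesis using t r2 by (simp add: B_def Phi_def add_increasing)
    qed
  qed
  have eq: "emeasure dA (ball (0::complex) s) = ennreal (1 / pi) * emeasure lborel (ball (0::complex) s)"
    unfolding dA_def by (subst emeasure_density) (auto simp: nn_integral_cmult_indicator)
  have fin: "emeasure dA (ball (0::complex) s) < \<infinity>"
    unfolding eq using emeasure_bounded_finite[OF bounded_ball, of "0::complex" s]
    by (simp add: ennreal_mult_less_top)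
  have meas: "(\<lambda>z. Phi (poly f) z r / (1 - (cmod z)\<^sup>2)) \<in> borel_measurable dA"
  proof -
    have [measurable]: "poly f \<in> borel_measurable borel"
      by (intro borel_measurable_continuous_onI continuous_intros)
    have [measurable]: "ball (0::complex) r \<in> sets borel" by simp
    have "(\<lambda>z. Phi (poly f) z r / (1 - (cmod z)\<^sup>2)) \<in> borel_measurable borel"
      unfolding Phi_def
      by (intro borel_measurable_divide borel_measurable_power borel_measurable_diff
          borel_measurable_times borel_measurable_norm borel_measurable_indicator) auto
    then show ?thesis by (simp add: dA_def)
  qed
  have A: "ball (0::complex) s \<in> sets dA" by (simp add: dA_def)
  show ?thesis unfolding set_integrable_def
    by (rule integrableI_bounded_set_indicator[OF A meas fin, where B = B])
       (use bound s in auto)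
qed

end

theory Submission
  imports Defs
begin

text \<open>
  Only \<open>\<rho>\<^sup>* \<le> \<rho>\<close> needs an argument. Let \<open>f = \<Sum> a\<^sub>n z\<^sup>n\<close> be nearly optimal for
  the radius \<open>r\<close>, put \<open>x = 1 - r\<^sup>2\<close>, and consider the radii \<open>s\<close> with \<open>1 - s\<^sup>2 = y = 2\<^sup>j x\<close>
  for \<open>1 \<le> j \<le> M\<close>. Let \<open>g\<close> be the part of \<open>f\<close> of degree below about \<open>1 / (4 y)\<close>. Monomials are
  orthogonal on annuli with respect to the weight \<open>1 - |z|\<^sup>2\<close>, so the sum of the squared norms
  of \<open>f - g\<close> on \<open>|z| < s\<close> and of \<open>g\<close> on \<open>s \<le> |z| < 1\<close> is a weighted sum of the \<open>|a\<^sub>n|\<^sup>2\<close>. Its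
  \<open>n\<close>-th weight decays geometrically as \<open>y\<close> moves away from \<open>1 / n\<close>; hence, summed over \<open>j\<close>, it is at
  most a constant times the squared norm of \<open>z\<^sup>n\<close> on \<open>|z| < r\<close>. The squared norm of \<open>f\<close> there
  is \<open>O(L)\<close> with \<open>L = log (1 / x)\<close>, so by the pigeonhole principle the error is \<open>O(L / M)\<close> for some
  \<open>j\<close>. For fixed \<open>M\<close> the normalisation \<open>log (1 / y) = L - j log 2\<close> is asymptotically equal to \<open>L\<close>, so
  \<open>\<rho>\<^sup>*\<close> exceeds \<open>\<rho>\<close> by an arbitrarily small amount as \<open>M\<close> grows.
\<close>

subsection \<open>Rotation invariance and radial integration\<close>

lemma power2_le_iff: "0 \<le> a \<Longrightarrow> 0 \<le> b \<Longrightarrow> a\<^sup>2 \<le> b\<^sup>2 \<longleftrightarrow> a \<le> (b::real)"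
  by (simp add: power_mono_iff)

lemma power2_less_iff: "0 \<le> a \<Longrightarrow> 0 \<le> b \<Longrightarrow> a\<^sup>2 < b\<^sup>2 \<longleftrightarrow> a < (b::real)"
  using power2_le_iff[of b a] by linarith

lemma sets_dA [simp, measurable_cong]: "sets dA = sets borel"
  by (simp add: dA_def)

lemma space_dA [simp]: "space dA = UNIV"
  by (simp add: dA_def)

lemma emeasure_dA:
  assumes "A \<in> sets borel"
  shows "emeasure dA A = ennreal (1 / pi) * emeasure lborel A"
  using assms unfolding dA_def
  by (subst emeasure_density) (auto simp: nn_integral_cmult_indicator)

lemma emeasure_dA_ball:
  assumes "0 \<le> r"
  shows "emeasure dA (ball 0 r) = ennreal (r\<^sup>2)"
  using assms
  by (simp add: emeasure_dA emeasure_ball unit_ball_vol_2 flip: ennreal_mult)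

text \<open>Carries area on the complex plane over to \<open>real^2\<close>, where the invariance of
  Lebesgue measure under orthogonal maps applies. Both sides agree on boxes.\<close>

lemma lborel_complex_vec: "distr lborel borel (\<lambda>v::real^2. Complex (v $ 1) (v $ 2)) = lborel"
proof (rule lborel_eqI[symmetric])
  fix l u :: complex
  assume le: "\<And>b. b \<in> Basis \<Longrightarrow> l \<bullet> b \<le> u \<bullet> b"
  have le': "Re l \<le> Re u" "Im l \<le> Im u"
    using le[of 1] le[of \<i>] by (auto simp: Basis_complex_def)
  let ?l = "vector [Re l, Im l] :: real^2" and ?u = "vector [Re u, Im u] :: real^2"
  have [measurable]: "(\<lambda>v::real^2. Complex (v $ 1) (v $ 2)) \<in> borel_measurable borel"
    by (intro borel_measurable_continuous_onI continuous_intros)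
  have B: "Basis = {axis 1 1, axis 2 1 :: real^2}"
    by (auto simp: Basis_vec_def UNIV_2)
  have pre: "(\<lambda>v::real^2. Complex (v $ 1) (v $ 2)) -` box l u = box ?l ?u"
    by (auto simp: box_def Basis_complex_def B inner_axis)
  have leb: "?l \<bullet> b \<le> ?u \<bullet> b" if "b \<in> Basis" for b
    using that le' by (auto simp: B inner_axis)
  have ne: "axis 1 1 \<noteq> (axis 2 1 :: real^2)" by (simp add: axis_eq_axis)
  show "emeasure (distr lborel borel (\<lambda>v::real^2. Complex (v $ 1) (v $ 2))) (box l u)
      = ennreal (\<Prod>b\<in>Basis. (u - l) \<bullet> b)"
    using leb ne le' by (subst emeasure_distr) (simp_all add: pre emeasure_lborel_box_eq B Basis_complex_def inner_axis)
qed simp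

text \<open>In real coordinates, multiplication by a unimodular \<open>a\<close> is an orthogonal
  matrix, so the claim is transported through \<open>T\<close>.\<close>

lemma lborel_rotate:
  assumes a: "cmod a = 1"
  shows "distr lborel borel (\<lambda>z. a * z) = lborel"
proof -
  define T where "T = (\<lambda>v::real^2. Complex (v $ 1) (v $ 2))"
  define f where "f = (\<lambda>v::real^2. vector [Re a * v $ 1 - Im a * v $ 2, Im a * v $ 1 + Re a * v $ 2] :: real^2)"
  \<comment> \<open>\<open>g\<close> is the transpose, hence the inverse, of \<open>f\<close>. It
    turns the preimage of a box under \<open>f\<close> into an orthogonal image of that box.\<close>
  define g where "g = (\<lambda>v::real^2. vector [Re a * v $ 1 + Im a * v $ 2, - Im a * v $ 1 + Re a * v $ 2] :: real^2)"
  have a2: "Re a * Re a + Im a * Im a = 1"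
    using a by (metis cmod_power2 power2_eq_square power_one)
  have fg: "f (g v) = v" "g (f v) = v" for v
  proof -
    have "f (g v) $ 1 = (Re a * Re a + Im a * Im a) * v $ 1" "f (g v) $ 2 = (Re a * Re a + Im a * Im a) * v $ 2"
        "g (f v) $ 1 = (Re a * Re a + Im a * Im a) * v $ 1" "g (f v) $ 2 = (Re a * Re a + Im a * Im a) * v $ 2"
      by (simp_all add: f_def g_def algebra_simps)
    then show "f (g v) = v" "g (f v) = v" unfolding a2 vec_eq_iff forall_2 by auto
  qed
  have lg: "linear g"
    by (rule linearI) (auto simp: g_def vec_eq_iff forall_2 algebra_simps)
  have lf: "linear f"
    by (rule linearI) (auto simp: f_def vec_eq_iff forall_2 algebra_simps)
  have og: "orthogonal_transformation g"
    unfolding orthogonal_transformation norm_eq_sqrt_inner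
  proof (intro conjI allI lg)
    fix v
    have "g v \<bullet> g v = (Re a * Re a + Im a * Im a) * (v \<bullet> v)"
      by (simp add: inner_vec_def sum_2 g_def algebra_simps)
    then show "sqrt (g v \<bullet> g v) = sqrt (v \<bullet> v)" using a2 by simp
  qed
  have [measurable]: "f \<in> borel_measurable borel" "T \<in> borel_measurable borel"
    unfolding T_def
    by (intro borel_measurable_continuous_onI linear_continuous_on linear_conv_bounded_linear[THEN iffD1] lf continuous_intros)+
  have df: "distr lborel borel f = lborel"
  proof (rule lborel_eqI[symmetric])
    fix l u :: "real^2"
    assume le: "\<And>b. b \<in> Basis \<Longrightarrow> l \<bullet> b \<le> u \<bullet> b"
    have im: "f -` box l u = g ` box l u"
      using fg by (auto simp: image_iff) metis
    have lm: "box l u \<in> lmeasurable" by simp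
    have gm: "g ` box l u \<in> lmeasurable" by (rule measurable_orthogonal_image[OF og lm])
    have gb: "g ` box l u \<in> sets borel"
      unfolding im[symmetric] using measurable_sets[of f borel borel "box l u"] by simp
    have "emeasure lborel (g ` box l u) = emeasure lebesgue (g ` box l u)"
      using gb by simp
    also have "\<dots> = measure lebesgue (g ` box l u)"
      using gm by (rule emeasure_eq_measure2)
    also have "\<dots> = measure lebesgue (box l u)"
      by (simp add: measure_orthogonal_image[OF og lm])
    also have "\<dots> = emeasure lebesgue (box l u)"
      using lm by (simp add: emeasure_eq_measure2)
    also have "\<dots> = (\<Prod>b\<in>Basis. (u - l) \<bullet> b)" using le by (simp add: emeasure_lborel_box_eq)
    finally show "emeasure (distr lborel borel f) (box l u) = (\<Prod>b\<in>Basis. (u - l) \<bullet> b)"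
      by (subst emeasure_distr) (auto simp: im)
  qed simp
  have [measurable]: "(\<lambda>z. a * z) \<in> borel_measurable borel" by simp
  have comp: "(\<lambda>z. a * z) \<circ> T = T \<circ> f"
    by (auto simp: T_def f_def complex_eq_iff)
  have dT: "distr lborel borel T = lborel" unfolding T_def by (rule lborel_complex_vec)
  have "distr lborel borel (\<lambda>z. a * z) = distr (distr lborel borel T) borel (\<lambda>z. a * z)"
    by (simp only: dT)
  also have "\<dots> = distr lborel borel (T \<circ> f)"
    by (subst distr_distr) (auto simp: comp)
  also have "\<dots> = distr (distr lborel borel f) borel T"
    by (subst distr_distr) auto
  also have "\<dots> = lborel" by (simp add: df dT)
  finally show ?thesis .
qed

lemma dA_rotate:
  assumes "cmod a = 1"
  shows "distr dA borel (\<lambda>z. a * z) = dA"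
proof (rule measure_eqI)
  fix A assume "A \<in> sets (distr dA borel (\<lambda>z. a * z))"
  then have [measurable]: "A \<in> sets borel" by simp
  have pre: "(\<lambda>z. a * z) -` A \<in> sets borel"
    using measurable_sets[of "\<lambda>z. a * z" borel borel A] by simp
  have "emeasure lborel A = emeasure (distr lborel borel (\<lambda>z. a * z)) A"
    by (simp add: lborel_rotate assms)
  also have "\<dots> = emeasure lborel ((\<lambda>z. a * z) -` A)"
    by (subst emeasure_distr) auto
  finally show "emeasure (distr dA borel (\<lambda>z. a * z)) A = emeasure dA A"
    using pre by (subst emeasure_distr) (auto simp: emeasure_dA)
qed simp

section \<open>Integrals of radial functions over annuli\<close>

abbreviation annulus :: "real \<Rightarrow> real \<Rightarrow> complex set" where
  "annulus s t \<equiv> {z. s \<le> cmod z \<and> cmod z < t}"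

lemma annulus_borel [measurable]: "annulus s t \<in> sets borel"
  by measurable

lemma set_integrable_dA_bounded:
  fixes f :: "complex \<Rightarrow> 'a::{banach, second_countable_topology}"
  assumes "A \<in> sets borel" "A \<subseteq> cball 0 R" "f \<in> borel_measurable borel" "\<And>z. z \<in> A \<Longrightarrow> norm (f z) \<le> B"
  shows "set_integrable dA A f"
  unfolding set_integrable_def
proof (rule integrableI_bounded_set_indicator[where B = B])
  have "emeasure lborel A < \<infinity>"
    using assms(2) by (intro emeasure_bounded_finite bounded_subset[OF bounded_cball])
  then show "emeasure dA A < \<infinity>" using assms(1)
    by (simp add: emeasure_dA ennreal_mult_less_top)
qed (use assms in auto)

lemma set_integrable_dA_continuous:
  fixes f :: "complex \<Rightarrow> 'a::{banach, second_countable_topology}"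
  assumes A: "A \<in> sets borel" "A \<subseteq> cball 0 R" and f: "continuous_on UNIV f"
  shows "set_integrable dA A f"
proof -
  have "bounded (f ` cball 0 R)"
    using f by (intro compact_imp_bounded compact_continuous_image compact_cball) (auto intro: continuous_on_subset)
  then obtain B where "\<And>z. z \<in> cball 0 R \<Longrightarrow> norm (f z) \<le> B"
    unfolding bounded_iff by blast
  then show ?thesis
    using A f by (intro set_integrable_dA_bounded[of A R f B]) (auto intro: borel_measurable_continuous_onI)
qed

text \<open>Under \<open>dA\<close> the disc of radius \<open>sqrt x\<close> has mass
  \<open>x\<close>, so on the unit disc \<open>|z|^2\<close> is uniformly distributed. Finite
  measures on the line that agree on all half-lines \<open>{x<..}\<close> are equal.\<close>

lemma distr_norm_square_dA:
  "distr (density dA (indicator (ball 0 1))) borel (\<lambda>z. (cmod z)\<^sup>2)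
     = density lborel (indicator {0..<1::real})" (is "?M = ?N")
proof (rule measure_eqI_lessThan)
  have N: "emeasure ?N {x<..} = (if x < 0 then 1 else ennreal (1 - x))" for x :: real
  proof -
    have "emeasure ?N {x<..} = emeasure lborel ({x<..} \<inter> {0..<1})"
      by (simp add: emeasure_restricted Int_commute)
    also have "\<dots> = (if x < 0 then 1 else ennreal (1 - x))"
    proof (cases "x < 0")
      case True
      then have "{x<..} \<inter> {0..<1} = {0..<1}" by auto
      then show ?thesis using True by simp
    next
      case False
      then have "{x<..} \<inter> {0..<1} = {x<..<1}" by auto
      then show ?thesis using False by (cases "x \<le> 1") (simp_all add: ennreal_neg)
    qed
    finally show ?thesis .
  qed
  have M: "emeasure ?M {x<..} = (if x < 0 then 1 else ennreal (1 - x))" for x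
  proof -
    let ?B = "{z. x < (cmod z)\<^sup>2}"
    have "emeasure ?M {x<..} = emeasure dA (?B \<inter> ball 0 1)"
      by (subst emeasure_distr) (auto simp: emeasure_restricted vimage_def Int_commute)
    also have "\<dots> = (if x < 0 then 1 else ennreal (1 - x))"
    proof (cases "x < 0")
      case True
      then have "?B = UNIV" using order.strict_trans2[OF True zero_le_power2] by auto
      then show ?thesis using True by (simp add: emeasure_dA_ball)
    next
      case False
      show ?thesis
      proof (cases "x < 1")
        case x1: True
        have "emeasure dA (cball 0 (sqrt x)) = ennreal x"
          using False by (simp add: emeasure_dA emeasure_cball unit_ball_vol_2 flip: ennreal_mult)
        moreover have "?B \<inter> ball 0 1 = ball 0 1 - cball 0 (sqrt x)"
          using False power2_le_iff[of _ "sqrt x"] by (auto simp: not_le[symmetric])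
        moreover have "cball 0 (sqrt x) \<subseteq> ball (0::complex) 1"
          using order.strict_trans1[of _ "sqrt x" 1] x1 by auto
        ultimately show ?thesis using False x1
          by (simp add: emeasure_Diff emeasure_dA_ball ennreal_minus flip: ennreal_1)
      next
        case x1: False
        have "(cmod z)\<^sup>2 \<le> x" if "z \<in> ball 0 1" for z
          using that x1 power_le_one[of "cmod z" 2] by simp
        then have "?B \<inter> ball 0 1 = {}" by (auto simp: not_le[symmetric])
        then show ?thesis using x1 False by (simp add: ennreal_neg)
      qed
    qed
    finally show ?thesis .
  qed
  show "emeasure ?M {x<..} < \<infinity>" for x by (simp add: M)
  show "emeasure ?M {x<..} = emeasure ?N {x<..}" for x by (simp add: M N)
qed auto

text \<open>The substitution \<open>u = |z|^2\<close>, carried out as a push-forward of measures;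
  the normalisation of \<open>dA\<close> makes the Jacobian factor 1.\<close>

lemma radial_integral:
  fixes g :: "real \<Rightarrow> real"
  assumes st: "0 \<le> s" "s \<le> t" "t \<le> 1" and g[measurable]: "g \<in> borel_measurable borel"
  shows "(LINT z:annulus s t|dA. g ((cmod z)\<^sup>2)) = (LINT u:{s\<^sup>2..<t\<^sup>2}|lborel. g u)"
proof -
  have t: "0 \<le> t" "t\<^sup>2 \<le> 1" using st by (auto simp: power_le_one)
  have *: "indicator (annulus s t) z = indicator (ball 0 1) z * (indicator {s\<^sup>2..<t\<^sup>2} ((cmod z)\<^sup>2) :: real)" for z
    using st t by (auto simp: indicator_def power2_le_iff power2_less_iff)
  have **: "indicator {s\<^sup>2..<t\<^sup>2} u = indicator {0..<1} u * (indicator {s\<^sup>2..<t\<^sup>2} u::real)" for u :: real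
    using t order_trans[OF zero_le_power2[of s], of u] by (auto simp: indicator_def)
  let ?h = "\<lambda>u. indicator {s\<^sup>2..<t\<^sup>2} u * g u"
  have "(LINT z:annulus s t|dA. g ((cmod z)\<^sup>2)) = (LINT z|dA. indicator (ball 0 1) z *\<^sub>R ?h ((cmod z)\<^sup>2))"
    unfolding set_lebesgue_integral_def by (simp add: * mult_ac)
  also have "\<dots> = (LINT z|density dA (indicator (ball 0 1)). ?h ((cmod z)\<^sup>2))"
    by (subst integral_density[symmetric]) (auto simp: ennreal_indicator intro!: borel_measurable_indicator)
  also have "\<dots> = (LINT u|distr (density dA (indicator (ball 0 1))) borel (\<lambda>z. (cmod z)\<^sup>2). ?h u)"
    by (subst integral_distr) auto
  also have "\<dots> = (LINT u|density lborel (indicator {0..<1::real}). ?h u)"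
    by (simp only: distr_norm_square_dA)
  also have "\<dots> = (LINT u|lborel. indicator {0..<1} u *\<^sub>R ?h u)"
    by (subst integral_density[symmetric]) (auto simp: ennreal_indicator intro!: borel_measurable_indicator)
  also have "\<dots> = (LINT u:{s\<^sup>2..<t\<^sup>2}|lborel. g u)"
    unfolding set_lebesgue_integral_def by (subst (2) **) (simp add: mult_ac)
  finally show ?thesis .
qed


lemma radial_integral_FTC:
  fixes g G :: "real \<Rightarrow> real"
  assumes st: "0 \<le> s" "s \<le> t" "t \<le> 1" and g: "g \<in> borel_measurable borel"
    and G: "\<And>u. \<lbrakk>s\<^sup>2 \<le> u; u \<le> t\<^sup>2\<rbrakk> \<Longrightarrow> (G has_real_derivative g u) (at u)"
    and cont: "\<And>u. \<lbrakk>s\<^sup>2 \<le> u; u \<le> t\<^sup>2\<rbrakk> \<Longrightarrow> isCont g u"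
  shows "(LINT z:annulus s t|dA. g ((cmod z)\<^sup>2)) = G (t\<^sup>2) - G (s\<^sup>2)"
proof -
  have le: "s\<^sup>2 \<le> t\<^sup>2" using st by (intro power_mono)
  note [measurable] = g
  have "(LINT z:annulus s t|dA. g ((cmod z)\<^sup>2)) = (LINT u:{s\<^sup>2..<t\<^sup>2}|lborel. g u)"
    by (rule radial_integral[OF st g])
  also have "\<dots> = (LINT u|lborel. g u * indicator {s\<^sup>2..t\<^sup>2} u)"
    unfolding set_lebesgue_integral_def
  proof (rule integral_cong_AE)
    show "AE u in lborel. indicator {s\<^sup>2..<t\<^sup>2} u *\<^sub>R g u = g u * indicator {s\<^sup>2..t\<^sup>2} u"
      using AE_lborel_singleton[of "t\<^sup>2"] by eventually_elim (auto simp: indicator_def)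
  qed auto
  also have "\<dots> = G (t\<^sup>2) - G (s\<^sup>2)"
    by (rule integral_FTC_Icc_real[OF le G cont])
  finally show ?thesis .
qed

subsection \<open>Orthogonality of monomials\<close>

text \<open>The antiderivative of \<open>(1 - u) * u ^ n\<close> that vanishes at 0. At
  \<open>R = r^2\<close> it is the squared norm of \<open>z ^ n\<close> on the disc of radius
  \<open>r\<close> with weight \<open>1 - |z|^2\<close>.\<close>

definition radial_weight :: "nat \<Rightarrow> real \<Rightarrow> real" where
  "radial_weight n R = R ^ (n + 1) / real (n + 1) - R ^ (n + 2) / real (n + 2)"

lemma radial_weight_deriv: "(radial_weight n has_real_derivative (1 - u) * u ^ n) (at u)"
proof -
  have *: "((\<lambda>R. R ^ Suc k / real (Suc k)) has_real_derivative u ^ k) (at u)" for k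
    using DERIV_cdivide[OF DERIV_pow[of "Suc k" u], of "real (Suc k)"] by (simp del: of_nat_Suc power_Suc)
  show ?thesis
    using DERIV_diff[OF *[of n] *[of "Suc n"]]
    by (simp add: radial_weight_def[abs_def] algebra_simps)
qed

lemma integral_monomial_annulus:
  assumes "0 \<le> s" "s \<le> t" "t \<le> 1"
  shows "(LINT z:annulus s t|dA. (1 - (cmod z)\<^sup>2) * ((cmod z)\<^sup>2) ^ n)
    = radial_weight n (t\<^sup>2) - radial_weight n (s\<^sup>2)"
  by (rule radial_integral_FTC[OF assms, where g = "\<lambda>u. (1 - u) * u ^ n"])
    (auto intro!: radial_weight_deriv continuous_intros)

lemma integral_inverse_weight:
  assumes r: "0 \<le> r" "r < 1"
  shows "(LINT z:ball 0 r|dA. 1 / (1 - (cmod z)\<^sup>2)) = ln (1 / (1 - r\<^sup>2))"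
proof -
  have r2: "r\<^sup>2 < 1" using r by (simp add: power_less_one_iff)
  have "annulus 0 r = ball 0 r" by auto
  moreover have "(LINT z:annulus 0 r|dA. 1 / (1 - (cmod z)\<^sup>2)) = - ln (1 - r\<^sup>2) - (- ln (1 - 0\<^sup>2))"
    using r r2
    by (intro radial_integral_FTC[where g = "\<lambda>u. 1 / (1 - u)" and G = "\<lambda>u. - ln (1 - u)"])
      (auto intro!: derivative_eq_intros continuous_intros)
  ultimately show ?thesis using r2 by (simp add: ln_div)
qed

text \<open>A suitable rotation preserves \<open>dA\<close>, the annulus and the weight but changes
  the sign of the integrand, so the integral equals its own negative.\<close>

lemma integral_mixed_monomial_annulus:
  assumes "n \<noteq> m"
  shows "(LINT z:annulus s t|dA. complex_of_real (1 - (cmod z)\<^sup>2) * (z ^ n * cnj z ^ m)) = 0"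
proof -
  \<comment> \<open>The angle is chosen so that the factor \<open>a ^ n * cnj a ^ m\<close>, of
    argument \<open>(n - m)\<close> times it, is \<open>-1\<close>. Subtracting in the reals covers
    \<open>n < m\<close> too.\<close>
  define a where "a = cis (pi / (real n - real m))"
  have a: "cmod a = 1" by (simp add: a_def)
  have "a ^ n * cnj a ^ m = cis ((real n - real m) * (pi / (real n - real m)))"
    unfolding a_def cis_cnj Complex.DeMoivre cis_mult by (simp add: left_diff_distrib diff_divide_distrib)
  also have "\<dots> = -1" using assms by simp
  finally have am: "a ^ n * cnj a ^ m = -1" .
  define F where "F z = indicator (annulus s t) z *\<^sub>R (complex_of_real (1 - (cmod z)\<^sup>2) * (z ^ n * cnj z ^ m))" for z
  have [measurable]: "cnj \<in> borel_measurable borel"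
    by (intro borel_measurable_continuous_onI continuous_intros)
  have [measurable]: "F \<in> borel_measurable borel"
    unfolding F_def by measurable
  have [measurable]: "(\<lambda>z. a * z) \<in> borel_measurable borel" by simp
  have Fa: "F (a * z) = - F z" for z
  proof -
    have "F (a * z) = (a ^ n * cnj a ^ m) * F z"
      by (simp add: F_def norm_mult a power_mult_distrib mult_ac indicator_def)
    then show ?thesis by (simp add: am)
  qed
  have "integral\<^sup>L dA F = integral\<^sup>L (distr dA borel (\<lambda>z. a * z)) F"
    by (simp only: dA_rotate[OF a])
  also have "\<dots> = (LINT z|dA. F (a * z))" by (subst integral_distr) auto
  also have "\<dots> = - integral\<^sup>L dA F" by (simp add: Fa)
  finally show ?thesis by (simp add: F_def[abs_def] set_lebesgue_integral_def)
qed

text \<open>Expanding the square gives a double sum in which only the diagonal survives. Free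
  coefficients \<open>c\<close> and a free bound \<open>N\<close> let one formula serve
  \<open>f\<close>, \<open>g\<close> and \<open>f - g\<close>.\<close>

lemma Parseval_annulus:
  fixes c :: "nat \<Rightarrow> complex"
  assumes st: "0 \<le> s" "s \<le> t" "t \<le> 1"
  shows "(LINT z:annulus s t|dA. (1 - (cmod z)\<^sup>2) * (cmod (\<Sum>n<N. c n * z ^ n))\<^sup>2)
    = (\<Sum>n<N. (cmod (c n))\<^sup>2 * (radial_weight n (t\<^sup>2) - radial_weight n (s\<^sup>2)))"
proof -
  let ?A = "annulus s t"
  define e where "e n m z = complex_of_real (1 - (cmod z)\<^sup>2) * (z ^ n * cnj z ^ m)" for n m z
  have sub: "?A \<subseteq> cball 0 1" using st by auto
  have int_e: "set_integrable dA ?A (e n m)" for n m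
    unfolding e_def using sub by (intro set_integrable_dA_continuous continuous_intros) auto
  have diag: "set_lebesgue_integral dA ?A (e n n) = of_real (radial_weight n (t\<^sup>2) - radial_weight n (s\<^sup>2))" for n
  proof -
    have "e n n = (\<lambda>z. complex_of_real ((1 - (cmod z)\<^sup>2) * ((cmod z)\<^sup>2) ^ n))"
      unfolding e_def of_real_mult of_real_power[of _ n] complex_norm_square power_mult_distrib ..
    then have "set_lebesgue_integral dA ?A (e n n) = of_real (LINT z:?A|dA. (1 - (cmod z)\<^sup>2) * ((cmod z)\<^sup>2) ^ n)"
      by (simp only: set_integral_complex_of_real)
    then show ?thesis by (simp only: integral_monomial_annulus[OF st])
  qed
  have off: "set_lebesgue_integral dA ?A (e n m) = 0" if "n \<noteq> m" for n m
    unfolding e_def by (rule integral_mixed_monomial_annulus[OF that])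
  have "complex_of_real ((1 - (cmod z)\<^sup>2) * (cmod (\<Sum>n<N. c n * z ^ n))\<^sup>2)
      = (\<Sum>n<N. \<Sum>m<N. c n * cnj (c m) * e n m z)" for z
  proof -
    have "complex_of_real ((cmod (\<Sum>n<N. c n * z ^ n))\<^sup>2) = (\<Sum>n<N. \<Sum>m<N. (c n * z ^ n) * cnj (c m * z ^ m))"
      by (simp only: complex_norm_square cnj_sum sum_product)
    then show ?thesis
      by (simp only: of_real_mult sum_distrib_left) (simp add: e_def mult_ac)
  qed
  then have "complex_of_real (LINT z:?A|dA. (1 - (cmod z)\<^sup>2) * (cmod (\<Sum>n<N. c n * z ^ n))\<^sup>2)
      = (LINT z:?A|dA. (\<Sum>n<N. \<Sum>m<N. c n * cnj (c m) * e n m z))"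
    by (simp only: set_integral_complex_of_real[symmetric])
  also have "\<dots> = (\<Sum>n<N. \<Sum>m<N. c n * cnj (c m) * set_lebesgue_integral dA ?A (e n m))"
    using int_e unfolding set_lebesgue_integral_def set_integrable_def
    by (simp add: scaleR_sum_right integral_sum flip: mult_scaleR_right)
  also have "\<dots> = (\<Sum>n<N. \<Sum>m<N. if m = n then complex_of_real ((cmod (c n))\<^sup>2 * (radial_weight n (t\<^sup>2) - radial_weight n (s\<^sup>2))) else 0)"
    by (intro sum.cong refl) (auto simp: diag off complex_norm_square simp del: of_real_diff of_real_power)
  also have "\<dots> = complex_of_real (\<Sum>n<N. (cmod (c n))\<^sup>2 * (radial_weight n (t\<^sup>2) - radial_weight n (s\<^sup>2)))"
    by (simp del: of_real_diff)
  finally show ?thesis by (simp only: of_real_eq_iff)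
qed

subsection \<open>Radial weights at dyadic scales\<close>

lemma radial_weight_mono:
  assumes "0 \<le> a" "a \<le> b" "b \<le> 1"
  shows "radial_weight n a \<le> radial_weight n b"
  by (rule DERIV_nonneg_imp_nondecreasing[OF assms(2)])
    (use assms in \<open>auto intro!: exI[of _ "(1 - _) * _ ^ n"] radial_weight_deriv mult_nonneg_nonneg\<close>)

text \<open>Since \<open>u ^ n \<le> 1\<close>, the density \<open>(1 - u) * u ^ n\<close> is at
  most \<open>1 - u\<close>, whose integral over \<open>[1 - y, 1]\<close> is
  \<open>y^2 / 2\<close>.\<close>

lemma radial_weight_tail_le:
  assumes "0 \<le> y" "y \<le> 1"
  shows "radial_weight n 1 - radial_weight n (1 - y) \<le> y\<^sup>2 / 2"
proof -
  let ?h = "\<lambda>u. radial_weight n u + (1 - u)\<^sup>2 / 2"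
  have "?h 1 \<le> ?h (1 - y)"
  proof (rule DERIV_nonpos_imp_nonincreasing[where f = ?h])
    fix u assume u: "1 - y \<le> u" "u \<le> 1"
    have "(?h has_real_derivative ((1 - u) * u ^ n - (1 - u))) (at u)"
      by (auto intro!: derivative_eq_intros radial_weight_deriv)
    moreover have "(1 - u) * u ^ n \<le> (1 - u) * 1"
      using u assms by (intro mult_left_mono power_le_one) auto
    ultimately show "\<exists>d. (?h has_real_derivative d) (at u) \<and> d \<le> 0"
      by (intro exI[of _ "(1 - u) * u ^ n - (1 - u)"]) auto
  qed (use assms in auto)
  then show ?thesis by simp
qed

text \<open>Isolates the power \<open>R ^ (n + 1)\<close>, the only factor that varies quickly, for
  the next two estimates.\<close>

lemma radial_weight_eq:
  "radial_weight n R = R ^ (n + 1) * (real (n + 2) * (1 - R) + R) / (real (n + 1) * real (n + 2))"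
proof -
  have "real (n + 1) \<noteq> 0" "real (n + 2) \<noteq> 0" by linarith+
  then show ?thesis
    unfolding radial_weight_def power_add[of R n 2] power_add[of R n 1]
    by (simp add: divide_simps del: of_nat_add) (simp add: algebra_simps power2_eq_square)
qed

text \<open>For degrees small against \<open>1 / x\<close>, Bernoulli's inequality keeps
  \<open>(1 - x) ^ (n + 2)\<close> above \<open>1 / 2\<close>, so a fixed part of the full mass
  \<open>1 / ((n + 1) * (n + 2))\<close> lies in the disc.\<close>

lemma radial_weight_lower:
  assumes x: "0 \<le> x" "real (n + 1) * x \<le> 1 / 4"
  shows "1 / (4 * (real (n + 1))\<^sup>2) \<le> radial_weight n (1 - x)"
proof -
  let ?D = "real (n + 1) * real (n + 2)"
  have D: "0 < ?D" by (intro mult_pos_pos) auto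
  have x1: "x \<le> 1 / 4" using x mult_right_mono[of 1 "real (n + 1)" x] by auto
  have nx: "real (n + 2) * x \<le> 1 / 2"
    using x x1 by (simp add: algebra_simps)
  have "1 / 2 \<le> 1 + real (n + 2) * (- x)" using nx by simp
  also have "\<dots> \<le> (1 + (- x)) ^ (n + 2)"
    using x1 by (intro Bernoulli_inequality) auto
  also have "\<dots> = (1 - x) ^ (n + 1) * (1 - x)" by simp
  also have "\<dots> \<le> (1 - x) ^ (n + 1) * (real (n + 2) * (1 - (1 - x)) + (1 - x))"
    using x x1 by (intro mult_left_mono zero_le_power) (auto intro: mult_nonneg_nonneg)
  finally have "(1 / 2) / ?D \<le> radial_weight n (1 - x)"
    unfolding radial_weight_eq using D by (intro divide_right_mono) auto
  moreover have "1 / (4 * (real (n + 1))\<^sup>2) \<le> (1 / 2) / ?D"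
    using D by (simp add: divide_simps power2_eq_square)
  ultimately show ?thesis by linarith
qed

text \<open>As \<open>y - x \<ge> y / 2\<close>, passing from \<open>1 - x\<close> to
  \<open>1 - y\<close> costs a factor \<open>exp (- y / 2)\<close>. Its power \<open>n + 1\<close>
  is \<open>exp (- u / 2)\<close>, which outweighs the linear factor in \<open>u\<close>.\<close>

lemma radial_weight_decay:
  assumes x: "0 < x" "2 * x \<le> y" "y \<le> 1 / 2"
  shows "radial_weight n (1 - y) \<le> 32 / (real (n + 1) * y) * radial_weight n (1 - x)"
proof -
  let ?D = "real (n + 1) * real (n + 2)"
  define u where "u = real (n + 1) * y"
  have D: "0 < ?D" by (intro mult_pos_pos) auto
  have u: "0 < u" using x unfolding u_def by (intro mult_pos_pos) auto
  have "1 - y \<le> (1 - x) * (1 - (y - x))"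
    using mult_nonneg_nonneg[of x "y - x"] x by (simp add: algebra_simps)
  also have "\<dots> \<le> (1 - x) * exp (- y / 2)"
    using x exp_ge_add_one_self[of "- y / 2"] by (intro mult_left_mono) auto
  finally have "(1 - y) ^ (n + 1) \<le> ((1 - x) * exp (- y / 2)) ^ (n + 1)"
    using x by (intro power_mono) auto
  also have "\<dots> = (1 - x) ^ (n + 1) * exp (- u / 2)"
    by (simp only: power_mult_distrib u_def flip: exp_of_nat_mult) simp
  also have "\<dots> \<le> (1 - x) ^ (n + 1) * (32 / (u * (4 * u + 2)))"
  proof (rule mult_left_mono)
    \<comment> \<open>The quadratic Taylor bound suffices: one order of decay cancels the factor
      \<open>2 * u + 1\<close>, the other leaves \<open>1 / u\<close>.\<close>
    have "1 + u / 2 + (u / 2)\<^sup>2 / 2 \<le> exp (u / 2)"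
      using u by (intro exp_lower_Taylor_quadratic) auto
    then have "u * (4 * u + 2) \<le> 32 * exp (u / 2)"
      using u by (simp add: power2_eq_square algebra_simps)
    then have "u * (4 * u + 2) * exp (- u / 2) \<le> 32 * exp (u / 2) * exp (- u / 2)"
      by (intro mult_right_mono) auto
    also have "\<dots> = 32" by (simp add: mult_exp_exp flip: mult.assoc)
    finally show "exp (- u / 2) \<le> 32 / (u * (4 * u + 2))"
      using u by (simp add: pos_le_divide_eq mult.commute)
  qed (use x in auto)
  finally have pow: "(1 - y) ^ (n + 1) \<le> (1 - x) ^ (n + 1) * (32 / (u * (4 * u + 2)))" .
  have "(1 - y) ^ (n + 1) * (real (n + 2) * (1 - (1 - y)) + (1 - y))
      \<le> ((1 - x) ^ (n + 1) * (32 / (u * (4 * u + 2)))) * (2 * u + 1)"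
  proof (intro mult_mono pow)
    show "real (n + 2) * (1 - (1 - y)) + (1 - y) \<le> 2 * u + 1"
      using x mult_nonneg_nonneg[of "real n" y] by (simp add: u_def algebra_simps)
  qed (use x u in auto)
  also have "\<dots> = 32 / u * ((1 - x) ^ (n + 1) * (1 / 2))"
    using u by (simp add: divide_simps)
  also have "\<dots> \<le> 32 / u * ((1 - x) ^ (n + 1) * (real (n + 2) * (1 - (1 - x)) + (1 - x)))"
    using x u mult_right_mono[of 1 "real (n + 2)" x] by (intro mult_left_mono) auto
  finally show ?thesis
    unfolding radial_weight_eq u_def[symmetric] using D
    by (simp only: times_divide_eq_right) (intro divide_right_mono; simp)
qed

text \<open>The terms grow geometrically up to the threshold and decay geometrically after it.
  Induction peels off the first term and doubles \<open>c\<close>. The right side is built for this: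
  \<open>- c\<close> pays for a small first term, and
  \<open>64 / c = 32 / c + 64 / (2 * c)\<close>.\<close>

lemma sum_dyadic_bound:
  fixes c :: real
  assumes "0 < c"
  shows "(\<Sum>j<M. if c * 2 ^ j \<le> 1 / 4 then c * 2 ^ j else 32 / (c * 2 ^ j))
    \<le> (if c \<le> 1 / 4 then 257 - c else 64 / c)"
  using assms
proof (induction M arbitrary: c)
  case (Suc M)
  have "(\<Sum>j<Suc M. if c * 2 ^ j \<le> 1 / 4 then c * 2 ^ j else 32 / (c * 2 ^ j))
    = (if c \<le> 1 / 4 then c else 32 / c) +
      (\<Sum>j<M. if (2 * c) * 2 ^ j \<le> 1 / 4 then (2 * c) * 2 ^ j else 32 / ((2 * c) * 2 ^ j))"
    by (subst sum.lessThan_Suc_shift) (simp add: mult_ac cong: if_cong)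
  also have "\<dots> \<le> (if c \<le> 1 / 4 then c else 32 / c) + (if 2 * c \<le> 1 / 4 then 257 - 2 * c else 64 / (2 * c))"
    using Suc.prems by (intro add_left_mono Suc.IH) auto
  also have "\<dots> \<le> (if c \<le> 1 / 4 then 257 - c else 64 / c)"
  proof -
    \<comment> \<open>Needed when doubling crosses the threshold,
      \<open>c \<le> 1 / 4 < 2 * c\<close>: then \<open>c + 32 / c \<le> 257 - c\<close>.\<close>
    have "32 / c \<le> 256" if "1 / 8 < c" using that by (simp add: divide_simps)
    then show ?thesis using Suc.prems by auto
  qed
  finally show ?case .
qed auto

text \<open>The mass a monomial of degree \<open>n\<close> contributes to the error when polynomials are cut off
  at degree about \<open>1 / (4 * y)\<close>, the disc in question having squared radius \<open>1 - y\<close>.\<close>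

definition cutoff_error :: "nat \<Rightarrow> real \<Rightarrow> real" where
  "cutoff_error n y = (if real (n + 1) * y \<le> 1 / 4
     then radial_weight n 1 - radial_weight n (1 - y) else radial_weight n (1 - y))"

text \<open>With \<open>u = (n + 1) * y\<close>, the error relative to the mass in the disc of
  squared radius \<open>1 - x\<close> is at most \<open>u\<close> below the cutoff and
  \<open>32 / u\<close> above it; the dyadic sum of these ratios is bounded independently of
  \<open>n\<close> and \<open>M\<close>.\<close>

lemma sum_cutoff_error_le:
  assumes x: "0 < x" "2 ^ M * x \<le> 1 / 2"
  shows "(\<Sum>j=1..M. cutoff_error n (2 ^ j * x)) \<le> 257 * radial_weight n (1 - x)"
proof -
  \<comment> \<open>The factor 2 shifts the scales \<open>j = 1..M\<close> to exponents starting at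
    0.\<close>
  define c where "c = 2 * (real (n + 1) * x)"
  have c: "0 < c" using x by (auto simp: c_def)
  let ?p = "\<lambda>u. if u \<le> 1 / 4 then u else 32 / u :: real"
  have W: "0 \<le> radial_weight n (1 - x)" if "x \<le> 1"
    using radial_weight_mono[of 0 "1 - x" n] that x by (simp add: radial_weight_def)
  have "cutoff_error n (2 ^ j * x) \<le> ?p (real (n + 1) * (2 ^ j * x)) * radial_weight n (1 - x)"
    if j: "j \<in> {1..M}" for j
  proof -
    let ?y = "2 ^ j * x" let ?u = "real (n + 1) * ?y"
    have "(2::real) \<le> 2 ^ j" using j self_le_power[of "2::real" j] by simp
    moreover have "(2::real) ^ j \<le> 2 ^ M" using j by (intro power_increasing) auto
    ultimately have "2 * x \<le> ?y" "?y \<le> 2 ^ M * x"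
      using x by (intro mult_right_mono; simp)+
    then have y: "2 * x \<le> ?y" "?y \<le> 1 / 2" using x by linarith+
    show ?thesis
    proof (cases "?u \<le> 1 / 4")
      case True
      have "real (n + 1) * x \<le> ?u" using x y by (intro mult_left_mono) auto
      then have low: "1 / (4 * (real (n + 1))\<^sup>2) \<le> radial_weight n (1 - x)"
        using True x(1) by (intro radial_weight_lower) linarith+
      have "radial_weight n 1 - radial_weight n (1 - ?y) \<le> ?y\<^sup>2 / 2"
        by (rule radial_weight_tail_le) (use x y in linarith)+
      then have "cutoff_error n ?y \<le> ?y\<^sup>2 / 2"
        unfolding cutoff_error_def using True by (simp only: if_True)
      also have "\<dots> = 2 * ?u\<^sup>2 * (1 / (4 * (real (n + 1))\<^sup>2))"
        by (simp add: power_mult_distrib del: of_nat_add)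
      also have "\<dots> \<le> ?u * radial_weight n (1 - x)"
      proof (rule mult_mono[OF _ low])
        have "2 * ?u * ?u \<le> 1 * ?u" using True x by (intro mult_right_mono) auto
        then show "2 * ?u\<^sup>2 \<le> ?u" by (simp only: power2_eq_square mult.assoc mult_1)
      qed (use x in auto)
      finally show ?thesis using True by (simp only: if_True)
    next
      case False
      then show ?thesis
        using radial_weight_decay[OF x(1) y, of n] by (simp add: cutoff_error_def)
    qed
  qed
  then have "(\<Sum>j=1..M. cutoff_error n (2 ^ j * x))
      \<le> (\<Sum>j=1..M. ?p (real (n + 1) * (2 ^ j * x)) * radial_weight n (1 - x))"
    by (rule sum_mono)
  also have "\<dots> = (\<Sum>j<M. ?p (c * 2 ^ j)) * radial_weight n (1 - x)"
  proof -
    have "real (n + 1) * (2 ^ Suc j * x) = c * 2 ^ j" for j by (simp add: c_def)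
    then show ?thesis
      by (simp only: sum_distrib_right One_nat_def sum.atLeast1_atMost_eq)
  qed
  also have "\<dots> \<le> 257 * radial_weight n (1 - x)"
  proof (rule mult_right_mono)
    have "64 / c \<le> 257" if "1 / 4 < c" using that by (simp add: divide_simps)
    then show "(\<Sum>j<M. ?p (c * 2 ^ j)) \<le> 257"
      using sum_dyadic_bound[OF c, of M] c by (auto split: if_splits)
    have "1 * x \<le> 2 ^ M * x" using x by (intro mult_right_mono) auto
    then have "x \<le> 1" using x by linarith
    then show "0 \<le> radial_weight n (1 - x)" by (rule W)
  qed
  finally show ?thesis .
qed

subsection \<open>Truncation of a nearly optimal polynomial\<close>

text \<open>Parseval turns each error into a sum of \<open>cutoff_error\<close> terms. Summed over
  all scales they are at most 257 times the norm of \<open>f\<close>, so some scale is no worse than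
  the mean.\<close>

lemma exists_good_cutoff:
  fixes f :: "complex poly"
  assumes r: "0 < r" "r < 1" and M: "0 < M" "2 ^ M * (1 - r\<^sup>2) \<le> 1 / 2"
  obtains j g where "j \<in> {1..M}"
    "(LINT z:ball 0 (sqrt (1 - 2 ^ j * (1 - r\<^sup>2)))|dA. (1 - (cmod z)\<^sup>2) * (cmod (poly f z - poly g z))\<^sup>2)
     + (LINT z:annulus (sqrt (1 - 2 ^ j * (1 - r\<^sup>2))) 1|dA. (1 - (cmod z)\<^sup>2) * (cmod (poly g z))\<^sup>2)
     \<le> 257 * (LINT z:ball 0 r|dA. (1 - (cmod z)\<^sup>2) * (cmod (poly f z))\<^sup>2) / real M"
proof -
  define x where "x = 1 - r\<^sup>2"
  define N where "N = Suc (degree f)"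
  define y where "y j = 2 ^ j * x" for j :: nat
  define low where "low j n \<longleftrightarrow> real (n + 1) * y j \<le> 1 / 4" for j n
  define g where "g j = (\<Sum>n<N. monom (if low j n then coeff f n else 0) n)" for j
  define I where "I j = (LINT z:ball 0 (sqrt (1 - y j))|dA. (1 - (cmod z)\<^sup>2) * (cmod (poly f z - poly (g j) z))\<^sup>2)
     + (LINT z:annulus (sqrt (1 - y j)) 1|dA. (1 - (cmod z)\<^sup>2) * (cmod (poly (g j) z))\<^sup>2)" for j
  define A where "A = (LINT z:ball 0 r|dA. (1 - (cmod z)\<^sup>2) * (cmod (poly f z))\<^sup>2)"
  have x: "0 < x" using r by (simp add: x_def power_less_one_iff)
  \<comment> \<open>Discs count as annuli of inner radius 0, where the radial weight vanishes
    (\<open>W0\<close>).\<close>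
  have ball: "ball 0 t = annulus 0 t" for t by auto
  have f: "poly f z = (\<Sum>n<N. coeff f n * z ^ n)" for z
    by (simp add: poly_altdef N_def lessThan_Suc_atMost)
  have g: "poly (g j) z = (\<Sum>n<N. (if low j n then coeff f n else 0) * z ^ n)" for j z
    by (simp add: g_def poly_sum poly_monom)
  have fg: "poly f z - poly (g j) z = (\<Sum>n<N. (if low j n then 0 else coeff f n) * z ^ n)" for j z
    unfolding f g sum_subtractf[symmetric] by (intro sum.cong) auto
  have W0: "radial_weight n 0 = 0" for n by (simp add: radial_weight_def)
  have A_eq: "A = (\<Sum>n<N. (cmod (coeff f n))\<^sup>2 * radial_weight n (1 - x))"
    unfolding A_def ball f using r by (subst Parseval_annulus) (auto simp: W0 x_def)
  have I_eq: "I j = (\<Sum>n<N. (cmod (coeff f n))\<^sup>2 * cutoff_error n (y j))" if j: "j \<in> {1..M}" for j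
  proof -
    have "(2::real) ^ j \<le> 2 ^ M" using j by (intro power_increasing) auto
    then have "y j \<le> 2 ^ M * x" unfolding y_def using x by (intro mult_right_mono) auto
    then have "y j \<le> 1 / 2" using M unfolding x_def by linarith
    moreover have "0 < y j" using x by (simp add: y_def)
    ultimately have y: "0 \<le> 1 - y j" "1 - y j \<le> 1" by auto
    have s: "0 \<le> sqrt (1 - y j)" "sqrt (1 - y j) \<le> 1" "(sqrt (1 - y j))\<^sup>2 = 1 - y j"
      using y by auto
    show ?thesis
      unfolding I_def fg unfolding g ball using s
      by (subst (1 2) Parseval_annulus)
        (auto simp: W0 cutoff_error_def low_def sum.distrib[symmetric] intro!: sum.cong)
  qed
  have "(\<Sum>j=1..M. I j) = (\<Sum>n<N. (cmod (coeff f n))\<^sup>2 * (\<Sum>j=1..M. cutoff_error n (y j)))"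
    unfolding sum_distrib_left by (subst sum.swap) (intro sum.cong refl I_eq)
  also have "\<dots> \<le> (\<Sum>n<N. (cmod (coeff f n))\<^sup>2 * (257 * radial_weight n (1 - x)))"
    unfolding y_def using x M by (intro sum_mono mult_left_mono sum_cutoff_error_le) (auto simp: x_def)
  also have "\<dots> = 257 * A" by (simp add: A_eq sum_distrib_left mult_ac)
  finally have sum: "(\<Sum>j=1..M. I j) \<le> 257 * A" .
  have "\<exists>j\<in>{1..M}. I j \<le> 257 * A / real M"
  proof (rule ccontr)
    assume "\<not> ?thesis"
    then have "257 * A / real M < I j" if "j \<in> {1..M}" for j using that by (meson not_le)
    then have "(\<Sum>j=1..M. 257 * A / real M) < (\<Sum>j=1..M. I j)"
      using M by (intro sum_strict_mono) auto
    then show False using sum M by simp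
  qed
  then obtain j where "j \<in> {1..M}" "I j \<le> 257 * A / real M" by blast
  then show ?thesis using that[of j "g j"] unfolding I_def A_def y_def x_def by blast
qed

section \<open>Comparison of the discrepancies of \<open>f\<close> and its truncation\<close>

lemma one_minus_norm_sq_pos: "z \<in> ball 0 1 \<Longrightarrow> 0 < 1 - (cmod z)\<^sup>2"
  by (simp add: power_less_one_iff)

lemma set_integrable_weighted:
  assumes "A \<in> sets borel" "A \<subseteq> cball 0 1"
  shows "set_integrable dA A (\<lambda>z. (1 - (cmod z)\<^sup>2) * (cmod (poly p z))\<^sup>2)"
  by (rule set_integrable_dA_continuous[OF assms]) (intro continuous_intros)

text \<open>Pointwise \<open>a^2 \<le> 2 * (a - 1)^2 + 2\<close> for
  \<open>a = (1 - |z|^2) * |f z|\<close>, divided by the weight. A bounded normalised discrepancy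
  thus bounds the norm of \<open>f\<close> by a multiple of the logarithm.\<close>

lemma weighted_norm_le_discrepancy:
  fixes f :: "complex poly"
  assumes r: "0 < r" "r < 1"
  shows "(LINT z:ball 0 r|dA. (1 - (cmod z)\<^sup>2) * (cmod (poly f z))\<^sup>2)
    \<le> 2 * (LINT z:ball 0 r|dA. Phi (poly f) z r / (1 - (cmod z)\<^sup>2)) + 2 * ln (1 / (1 - r\<^sup>2))"
proof -
  have r2: "r\<^sup>2 < 1" using r by (simp add: power_less_one_iff)
  have sub: "ball 0 r \<subseteq> cball (0::complex) 1" using r by auto
  have intPhi: "set_integrable dA (ball 0 r) (\<lambda>z. Phi (poly f) z r / (1 - (cmod z)\<^sup>2))"
    using r by (intro set_integrable_Phi) auto
  have int1: "set_integrable dA (ball 0 r) (\<lambda>z. 1 / (1 - (cmod z)\<^sup>2))"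
  proof (rule set_integrable_dA_bounded[of _ 1 _ "1 / (1 - r\<^sup>2)"])
    fix z :: complex assume "z \<in> ball 0 r"
    then have "(cmod z)\<^sup>2 \<le> r\<^sup>2" by (intro power_mono) auto
    then show "norm (1 / (1 - (cmod z)\<^sup>2)) \<le> 1 / (1 - r\<^sup>2)" using r2 by (simp add: frac_le)
  qed (use r in auto)
  have "(LINT z:ball 0 r|dA. (1 - (cmod z)\<^sup>2) * (cmod (poly f z))\<^sup>2)
    \<le> (LINT z:ball 0 r|dA. 2 * (Phi (poly f) z r / (1 - (cmod z)\<^sup>2)) + 2 * (1 / (1 - (cmod z)\<^sup>2)))"
  proof (rule set_integral_mono)
    fix z :: complex assume z: "z \<in> ball 0 r"
    define t where "t = 1 - (cmod z)\<^sup>2"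
    define v where "v = cmod (poly f z)"
    have t: "0 < t" using z r one_minus_norm_sq_pos[of z] by (simp add: t_def)
    \<comment> \<open>This square is exactly the difference of the two sides of that inequality,
      with \<open>a = t * v\<close>.\<close>
    have "0 \<le> (t * v - 2)\<^sup>2" by simp
    then have "t * v\<^sup>2 * t \<le> 2 * (t * v - 1)\<^sup>2 + 2" by (simp add: power2_eq_square algebra_simps)
    then have "t * v\<^sup>2 \<le> (2 * (t * v - 1)\<^sup>2 + 2) / t" using t by (simp add: pos_le_divide_eq)
    then show "(1 - (cmod z)\<^sup>2) * (cmod (poly f z))\<^sup>2
        \<le> 2 * (Phi (poly f) z r / (1 - (cmod z)\<^sup>2)) + 2 * (1 / (1 - (cmod z)\<^sup>2))"
      using z by (simp add: Phi_def t_def v_def add_divide_distrib)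
  qed (intro set_integral_add set_integrable_mult_right set_integrable_weighted sub intPhi int1 borel_open open_ball)+
  also have "\<dots> = 2 * (LINT z:ball 0 r|dA. Phi (poly f) z r / (1 - (cmod z)\<^sup>2)) + 2 * ln (1 / (1 - r\<^sup>2))"
    by (simp only: set_integral_mult_right integral_inverse_weight[OF less_imp_le[OF r(1)] r(2)]
        set_integral_add(2)[OF set_integrable_mult_right[OF intPhi] set_integrable_mult_right[OF int1]])
  finally show ?thesis .
qed

text \<open>The difference of the sides is \<open>(\<eta> * a - b)^2 / \<eta>\<close>. A small
  \<open>\<eta>\<close> keeps the main term almost unchanged at the price of a large factor on the
  error.\<close>

lemma square_add_le_weighted:
  fixes a b \<eta> :: real
  assumes "0 < \<eta>"
  shows "(a + b)\<^sup>2 \<le> (1 + \<eta>) * a\<^sup>2 + (1 + 1 / \<eta>) * b\<^sup>2"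
proof -
  have "0 \<le> (\<eta> * a - b)\<^sup>2 / \<eta>" using assms by simp
  then show ?thesis using assms by (simp add: power2_eq_square field_simps)
qed

text \<open>Inside radius \<open>s\<close> the values \<open>|g|\<close> and \<open>|f|\<close>
  differ by at most \<open>|f - g|\<close>; outside, the indicator is 0 and the integrand is just
  the weighted square of \<open>g\<close>.\<close>

lemma tight_discrepancy_le:
  fixes f g :: "complex poly"
  assumes s: "0 < s" "s \<le> r" "r < 1" and \<eta>: "0 < \<eta>"
  shows "(LINT z:ball 0 1|dA. Phi (poly g) z s / (1 - (cmod z)\<^sup>2))
    \<le> (1 + \<eta>) * (LINT z:ball 0 r|dA. Phi (poly f) z r / (1 - (cmod z)\<^sup>2))
     + (1 + 1 / \<eta>) * ((LINT z:ball 0 s|dA. (1 - (cmod z)\<^sup>2) * (cmod (poly f z - poly g z))\<^sup>2)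
        + (LINT z:annulus s 1|dA. (1 - (cmod z)\<^sup>2) * (cmod (poly g z))\<^sup>2))"
proof -
  let ?w = "\<lambda>z. 1 - (cmod z)\<^sup>2"
  have split: "ball 0 1 = ball 0 s \<union> annulus s 1" "ball 0 s \<inter> annulus s 1 = {}" using s by auto
  have intg: "set_integrable dA (ball 0 1) (\<lambda>z. Phi (poly g) z s / ?w z)"
    using s by (intro set_integrable_Phi) auto
  have intgs: "set_integrable dA (ball 0 s) (\<lambda>z. Phi (poly g) z s / ?w z)"
    using s by (intro set_integrable_subset[OF intg]) auto
  have intf: "set_integrable dA (ball 0 r) (\<lambda>z. Phi (poly f) z r / ?w z)"
    using s by (intro set_integrable_Phi) auto
  have intfs: "set_integrable dA (ball 0 s) (\<lambda>z. Phi (poly f) z r / ?w z)"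
    using s by (intro set_integrable_subset[OF intf]) auto
  have sub: "ball 0 s \<subseteq> cball (0::complex) 1" using s by auto
  have intd: "set_integrable dA (ball 0 s) (\<lambda>z. ?w z * (cmod (poly f z - poly g z))\<^sup>2)"
    using set_integrable_weighted[OF _ sub, of "f - g"] by simp
  have total: "(LINT z:ball 0 1|dA. Phi (poly g) z s / ?w z)
      = (LINT z:ball 0 s|dA. Phi (poly g) z s / ?w z) + (LINT z:annulus s 1|dA. Phi (poly g) z s / ?w z)"
    unfolding split(1) using split
    by (intro set_integral_Un set_integrable_subset[OF intg]) auto
  have tail: "(LINT z:annulus s 1|dA. Phi (poly g) z s / ?w z)
      = (LINT z:annulus s 1|dA. ?w z * (cmod (poly g z))\<^sup>2)"
  proof (rule set_lebesgue_integral_cong)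
    show "\<forall>z. z \<in> annulus s 1 \<longrightarrow> Phi (poly g) z s / ?w z = ?w z * (cmod (poly g z))\<^sup>2"
    proof (intro allI impI)
      fix z :: complex assume z: "z \<in> annulus s 1"
      then have "0 < ?w z" by (intro one_minus_norm_sq_pos) auto
      then show "Phi (poly g) z s / ?w z = ?w z * (cmod (poly g z))\<^sup>2"
        using z by (simp add: Phi_def power2_eq_square)
    qed
  qed simp
  have tail_le: "(LINT z:annulus s 1|dA. ?w z * (cmod (poly g z))\<^sup>2)
    \<le> (1 + 1 / \<eta>) * (LINT z:annulus s 1|dA. ?w z * (cmod (poly g z))\<^sup>2)"
  proof -
    have "0 \<le> (LINT z:annulus s 1|dA. ?w z * (cmod (poly g z))\<^sup>2)"
      unfolding set_lebesgue_integral_def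
      by (intro integral_nonneg_AE AE_I2) (auto simp: indicator_def power_le_one)
    then show ?thesis using \<eta> by (simp add: algebra_simps)
  qed
  have "(LINT z:ball 0 s|dA. Phi (poly g) z s / ?w z)
    \<le> (LINT z:ball 0 s|dA. (1 + \<eta>) * (Phi (poly f) z r / ?w z)
        + (1 + 1 / \<eta>) * (?w z * (cmod (poly f z - poly g z))\<^sup>2))"
  proof (rule set_integral_mono)
    fix z :: complex assume z: "z \<in> ball 0 s"
    define t where "t = ?w z"
    define u v where "u = cmod (poly f z)" and "v = cmod (poly g z)"
    define d where "d = cmod (poly f z - poly g z)"
    have t: "0 < t" using z s one_minus_norm_sq_pos[of z] by (simp add: t_def)
    have "\<bar>v - u\<bar> \<le> d" unfolding u_def v_def d_def
      using norm_triangle_ineq3[of "poly f z" "poly g z"] by (simp add: abs_minus_commute)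
    then have "(t * (v - u))\<^sup>2 \<le> t\<^sup>2 * d\<^sup>2"
      unfolding power_mult_distrib by (intro mult_left_mono) (auto simp: abs_le_square_iff[symmetric])
    have "(t * v - 1)\<^sup>2 = ((t * u - 1) + t * (v - u))\<^sup>2" by (simp add: algebra_simps)
    also have "\<dots> \<le> (1 + \<eta>) * (t * u - 1)\<^sup>2 + (1 + 1 / \<eta>) * (t * (v - u))\<^sup>2"
      by (rule square_add_le_weighted[OF \<eta>])
    also have "\<dots> \<le> (1 + \<eta>) * (t * u - 1)\<^sup>2 + (1 + 1 / \<eta>) * (t\<^sup>2 * d\<^sup>2)"
      using \<eta> \<open>(t * (v - u))\<^sup>2 \<le> t\<^sup>2 * d\<^sup>2\<close> by (intro add_left_mono mult_left_mono) auto
    finally have "(t * v - 1)\<^sup>2 / t \<le> ((1 + \<eta>) * (t * u - 1)\<^sup>2 + (1 + 1 / \<eta>) * (t\<^sup>2 * d\<^sup>2)) / t"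
      using t by (intro divide_right_mono) auto
    also have "\<dots> = (1 + \<eta>) * ((t * u - 1)\<^sup>2 / t) + (1 + 1 / \<eta>) * (t * d\<^sup>2)"
      using t by (simp add: add_divide_distrib power2_eq_square)
    finally show "Phi (poly g) z s / ?w z
        \<le> (1 + \<eta>) * (Phi (poly f) z r / ?w z) + (1 + 1 / \<eta>) * (?w z * (cmod (poly f z - poly g z))\<^sup>2)"
      using z s by (simp add: Phi_def t_def u_def v_def d_def)
  qed (intro set_integral_add set_integrable_mult_right intgs intfs intd)+
  also have "\<dots> = (1 + \<eta>) * (LINT z:ball 0 s|dA. Phi (poly f) z r / ?w z)
      + (1 + 1 / \<eta>) * (LINT z:ball 0 s|dA. ?w z * (cmod (poly f z - poly g z))\<^sup>2)"
    by (simp only: set_integral_mult_right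
        set_integral_add(2)[OF set_integrable_mult_right[OF intfs] set_integrable_mult_right[OF intd]])
  finally have main: "(LINT z:ball 0 s|dA. Phi (poly g) z s / ?w z)
    \<le> (1 + \<eta>) * (LINT z:ball 0 s|dA. Phi (poly f) z r / ?w z)
      + (1 + 1 / \<eta>) * (LINT z:ball 0 s|dA. ?w z * (cmod (poly f z - poly g z))\<^sup>2)" .
  \<comment> \<open>The integrand is nonnegative, so the disc may be enlarged from \<open>s\<close>
    to \<open>r\<close>.\<close>
  have "(LINT z:ball 0 s|dA. Phi (poly f) z r / ?w z) \<le> (LINT z:ball 0 r|dA. Phi (poly f) z r / ?w z)"
    using intf intfs s unfolding set_lebesgue_integral_def set_integrable_def
    by (intro integral_mono) (auto simp: indicator_def Phi_def power_le_one)
  then have "(1 + \<eta>) * (LINT z:ball 0 s|dA. Phi (poly f) z r / ?w z)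
      \<le> (1 + \<eta>) * (LINT z:ball 0 r|dA. Phi (poly f) z r / ?w z)"
    using \<eta> by (intro mult_left_mono) auto
  then show ?thesis
    unfolding total tail distrib_left add.assoc[symmetric]
    by (intro add_mono[OF _ tail_le] order_trans[OF main] add_right_mono)
qed

section \<open>Normalised discrepancies at fixed radii\<close>

lemma rho_H_r_le_star:
  assumes r: "0 < r" "r < 1"
  shows "rho_H_r r f \<le> rho_H_star_r r f"
proof -
  have r2: "r\<^sup>2 < 1" using r by (simp add: power_less_one_iff)
  have "(LINT z:ball 0 r|dA. Phi (poly f) z r / (1 - (cmod z)\<^sup>2))
    \<le> (LINT z:ball 0 1|dA. Phi (poly f) z r / (1 - (cmod z)\<^sup>2))"
    using set_integrable_Phi[OF r, of r f] set_integrable_Phi[OF r, of 1 f] r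
    unfolding set_lebesgue_integral_def set_integrable_def
    by (intro integral_mono) (auto simp: indicator_def Phi_def power_le_one)
  moreover have "0 < ln (1 / (1 - r\<^sup>2))" using r2 r by (intro ln_gt_zero) auto
  ultimately show ?thesis
    unfolding rho_H_r_def rho_H_star_r_def by (intro mult_left_mono) auto
qed

lemma rho_H_r_nonneg:
  assumes r: "0 < r" "r < 1"
  shows "0 \<le> rho_H_r r f"
proof -
  have "r\<^sup>2 < 1" using r by (simp add: power_less_one_iff)
  then have "0 \<le> ln (1 / (1 - r\<^sup>2))" by (intro ln_ge_zero) auto
  moreover have "0 \<le> (LINT z:ball 0 r|dA. Phi (poly f) z r / (1 - (cmod z)\<^sup>2))"
    unfolding set_lebesgue_integral_def using r
    by (intro integral_nonneg_AE AE_I2) (auto simp: indicator_def Phi_def power_le_one)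
  ultimately show ?thesis unfolding rho_H_r_def by simp
qed

text \<open>The quantitative transfer from \<open>(r, f)\<close> to \<open>(s, g)\<close>.
  \<open>C\<close> bounds the integral for \<open>g\<close> in units of the old logarithm, and
  \<open>large\<close> absorbs the change of normalisation. The constant 514 is
  \<open>2 * 257\<close>, from the norm bound and the cutoff bound.\<close>

lemma rho_H_star_r_near:
  fixes f :: "complex poly"
  assumes r: "0 < r" "r < 1" and f: "rho_H_r r f \<le> c" and \<eta>: "0 < \<eta>"
    and M: "0 < M" "2 ^ M * (1 - r\<^sup>2) \<le> 1 / 2"
    and C: "(1 + \<eta>) * c + (1 + 1 / \<eta>) * (514 * (c + 1) / real M) \<le> C"
    and large: "C * ln (1 / (1 - r\<^sup>2)) \<le> c' * (ln (1 / (1 - r\<^sup>2)) - real M * ln 2)" and c': "0 \<le> c'"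
  obtains s g where "0 < s" "s < 1" "1 - 2 ^ M * (1 - r\<^sup>2) \<le> s\<^sup>2" "rho_H_star_r s g \<le> c'"
proof -
  define x where "x = 1 - r\<^sup>2"
  define L where "L = ln (1 / x)"
  define X where "X = (LINT z:ball 0 r|dA. Phi (poly f) z r / (1 - (cmod z)\<^sup>2))"
  have x: "0 < x" "x < 1" using r by (auto simp: x_def power_less_one_iff)
  have L: "0 < L" unfolding L_def using x by (intro ln_gt_zero) auto
  have "rho_H_r r f = X / L" by (simp add: rho_H_r_def X_def L_def x_def)
  then have XL: "X \<le> c * L" using f L by (simp add: pos_divide_le_eq)
  obtain j g where j: "j \<in> {1..M}" and
    jg: "(LINT z:ball 0 (sqrt (1 - 2 ^ j * x))|dA. (1 - (cmod z)\<^sup>2) * (cmod (poly f z - poly g z))\<^sup>2)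
     + (LINT z:annulus (sqrt (1 - 2 ^ j * x)) 1|dA. (1 - (cmod z)\<^sup>2) * (cmod (poly g z))\<^sup>2)
     \<le> 257 * (LINT z:ball 0 r|dA. (1 - (cmod z)\<^sup>2) * (cmod (poly f z))\<^sup>2) / real M" (is "?E \<le> _")
    using exists_good_cutoff[OF r M, of f] unfolding x_def by blast
  have Mx: "2 ^ M * x \<le> 1 / 2" using M by (simp add: x_def)
  define y where "y = 2 ^ j * x"
  define s where "s = sqrt (1 - y)"
  have "(2::real) ^ j \<le> 2 ^ M" using j by (intro power_increasing) auto
  then have yM: "y \<le> 2 ^ M * x" unfolding y_def using x by (intro mult_right_mono) auto
  have "1 * x \<le> y" unfolding y_def using x by (intro mult_right_mono) auto
  then have y: "x \<le> y" "0 < y" "y \<le> 1 / 2" using x yM Mx by linarith+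
  have s: "0 < s" "s < 1" "s\<^sup>2 = 1 - y" using y by (auto simp: s_def)
  have "s\<^sup>2 \<le> r\<^sup>2" using s y by (simp add: x_def)
  then have sr: "s \<le> r" by (rule power2_le_imp_le) (use r in auto)
  have "?E \<le> 257 * (2 * X + 2 * L) / real M"
  proof -
    have "257 * (LINT z:ball 0 r|dA. (1 - (cmod z)\<^sup>2) * (cmod (poly f z))\<^sup>2) / real M \<le> 257 * (2 * X + 2 * L) / real M"
      unfolding X_def L_def x_def
      by (intro divide_right_mono mult_left_mono weighted_norm_le_discrepancy r) auto
    then show ?thesis using jg by linarith
  qed
  also have "\<dots> \<le> 257 * (2 * (c * L) + 2 * L) / real M"
    using XL by (intro divide_right_mono mult_left_mono) auto
  also have "\<dots> = 514 * (c + 1) / real M * L" by (simp add: algebra_simps)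
  finally have E: "?E \<le> 514 * (c + 1) / real M * L" .
  have "(LINT z:ball 0 1|dA. Phi (poly g) z s / (1 - (cmod z)\<^sup>2)) \<le> (1 + \<eta>) * X + (1 + 1 / \<eta>) * ?E"
    using tight_discrepancy_le[OF s(1) sr r(2) \<eta>, of g f] unfolding X_def s_def y_def .
  also have "\<dots> \<le> (1 + \<eta>) * (c * L) + (1 + 1 / \<eta>) * (514 * (c + 1) / real M * L)"
    using \<eta> by (intro add_mono mult_left_mono XL E) auto
  also have "\<dots> = ((1 + \<eta>) * c + (1 + 1 / \<eta>) * (514 * (c + 1) / real M)) * L"
    by (simp add: algebra_simps)
  also have "\<dots> \<le> C * L" using C L by (intro mult_right_mono) auto
  also have "\<dots> \<le> c' * (L - real M * ln 2)" using large by (simp add: L_def x_def)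
  also have "\<dots> \<le> c' * ln (1 / (1 - s\<^sup>2))"
  proof (intro mult_left_mono c')
    \<comment> \<open>Multiplying \<open>x\<close> by \<open>2 ^ j\<close> lowers the logarithm by
      only \<open>j * ln 2\<close>, at most \<open>M * ln 2\<close>.\<close>
    have "ln (1 / (1 - s\<^sup>2)) = L - real j * ln 2"
      using x by (simp add: s L_def y_def ln_div ln_mult ln_realpow)
    moreover have "real j * ln 2 \<le> real M * ln 2" using j by (intro mult_right_mono) auto
    ultimately show "L - real M * ln 2 \<le> ln (1 / (1 - s\<^sup>2))" by linarith
  qed
  finally have "(LINT z:ball 0 1|dA. Phi (poly g) z s / (1 - (cmod z)\<^sup>2)) \<le> c' * ln (1 / (1 - s\<^sup>2))" .
  moreover have "0 < ln (1 / (1 - s\<^sup>2))" using y by (intro ln_gt_zero) (auto simp: s)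
  ultimately have "rho_H_star_r s g \<le> c'"
    unfolding rho_H_star_r_def by (simp add: pos_divide_le_eq del: ln_div)
  moreover have "1 - 2 ^ M * (1 - r\<^sup>2) \<le> s\<^sup>2" using yM s by (simp add: x_def)
  ultimately show ?thesis using that s by blast
qed

section \<open>Passage to the lower limits\<close>

lemma rho_H_less_imp_frequently:
  assumes "rho_H < ereal c" "b < 1"
  obtains r f where "b < r" "r < 1" "rho_H_r r f < c"
proof -
  have "\<not> eventually (\<lambda>r. ereal c \<le> (INF f. ereal (rho_H_r r f))) (at_left 1)"
    using assms(1) Liminf_bounded[of "ereal c" _ "at_left (1::real)"] unfolding rho_H_def by (meson not_le)
  then obtain r where r: "b < r" "r < 1" "(INF f. ereal (rho_H_r r f)) < ereal c"
    unfolding eventually_at_left_field using assms(2) by (meson not_le)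
  then obtain f where "rho_H_r r f < c" by (auto simp: INF_less_iff)
  then show ?thesis using that r by blast
qed

text \<open>Lower bounds hold for all radii near 1, whereas upper bounds hold only for some radii
  arbitrarily near 1. Hence the new radius \<open>s\<close> need only be close to 1 to give a
  contradiction.\<close>

lemma less_rho_H_star_imp_eventually:
  assumes "ereal c < rho_H_star"
  obtains b where "b < 1" "\<And>s g. b < s \<Longrightarrow> s < 1 \<Longrightarrow> c < rho_H_star_r s g"
proof -
  have "eventually (\<lambda>r. ereal c < (INF f. ereal (rho_H_star_r r f))) (at_left 1)"
    using assms unfolding rho_H_star_def by (rule less_LiminfD)
  then obtain b where b: "b < 1" "\<And>s. b < s \<Longrightarrow> s < 1 \<Longrightarrow> ereal c < (INF f. ereal (rho_H_star_r s f))"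
    unfolding eventually_at_left_field by blast
  show ?thesis
  proof (rule that[OF b(1)])
    fix s g assume "b < s" "s < 1"
    then have "ereal c < ereal (rho_H_star_r s g)" using b(2) INF_lower less_le_trans by (metis UNIV_I)
    then show "c < rho_H_star_r s g" by simp
  qed
qed

theorem theorem1p2:
  shows "rho_H = rho_H_star"
proof (rule antisym)
  have "eventually (\<lambda>r. 0 < r \<and> r < 1) (at_left (1::real))"
    unfolding eventually_at_left_field by (intro exI[of _ 0]) auto
  then have "eventually (\<lambda>r. (INF f. ereal (rho_H_r r f)) \<le> (INF f. ereal (rho_H_star_r r f))) (at_left 1)"
    by eventually_elim (auto intro!: INF_mono' rho_H_r_le_star)
  then show "rho_H \<le> rho_H_star" unfolding rho_H_def rho_H_star_def by (rule Liminf_mono)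
  show "rho_H_star \<le> rho_H"
  proof (rule ccontr)
    assume "\<not> ?thesis"
    \<comment> \<open>The gap between \<open>c\<close> and the later \<open>c'\<close> pays for all
      losses.\<close>
    then obtain c where c: "rho_H < ereal c" "ereal c < rho_H_star" by (meson ereal_dense2 not_le)
    obtain c' where c': "ereal c < ereal c'" "ereal c' < rho_H_star" using ereal_dense2[OF c(2)] by blast
    \<comment> \<open>A single sample shows \<open>c > 0\<close>, which permits dividing by
      \<open>c\<close> in \<open>\<eta>\<close>.\<close>
    obtain r0 f0 where "0 < r0" "r0 < 1" "rho_H_r r0 f0 < c"
      using rho_H_less_imp_frequently[OF c(1), of 0] by auto
    then have c0: "0 < c" using rho_H_r_nonneg[of r0 f0] by linarith
    obtain b where b: "b < 1" "\<And>s g. b < s \<Longrightarrow> s < 1 \<Longrightarrow> c' < rho_H_star_r s g"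
      using less_rho_H_star_imp_eventually[OF c'(2)] by blast
    have cc: "c < c'" using c' by simp
    define b0 where "b0 = max b 0"
    have b0: "b \<le> b0" "0 \<le> b0" "b0 < 1" using b(1) by (auto simp: b0_def)
    \<comment> \<open>Makes \<open>(1 + \<eta>) * c\<close> the midpoint of \<open>c\<close> and
      \<open>c'\<close>.\<close>
    define \<eta> where "\<eta> = (c' - c) / (2 * c)"
    have \<eta>0: "0 < \<eta>" using cc c0 by (simp add: \<eta>_def)
    have "\<eta> * c = (c' - c) / 2" using c0 by (simp add: \<eta>_def)
    then have \<eta>: "(1 + \<eta>) * c = (c + c') / 2" by (simp add: distrib_right field_simps)
    define K where "K = (1 + 1 / \<eta>) * (514 * (c + 1))"
    have K: "0 < K" unfolding K_def using \<eta>0 c0 by (intro mult_pos_pos add_pos_pos) auto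
    \<comment> \<open>Makes the error \<open>q = K / M\<close> less than a quarter of the gap, so
      that \<open>C < c'\<close>.\<close>
    obtain M :: nat where M: "4 * K / (c' - c) < real M" using reals_Archimedean2 by blast
    have "0 < 4 * K / (c' - c)" using K cc by simp
    then have M0: "0 < M" using M by (cases M) auto
    define q where "q = K / real M"
    define C where "C = (c + c') / 2 + q"
    have "4 * K < real M * (c' - c)" using M cc by (simp add: pos_divide_less_eq)
    then have "q < (c' - c) / 4" using M0 by (simp add: q_def pos_divide_less_eq mult.commute)
    then have C: "C < c'" unfolding C_def using cc by (simp add: field_simps)
    \<comment> \<open>Once \<open>ln (1 / x)\<close> exceeds \<open>B\<close>, the slack
      \<open>c' - C\<close> covers the loss \<open>M * ln 2\<close> in the logarithm.\<close>
    define B where "B = c' * (real M * ln 2) / (c' - C)"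
    \<comment> \<open>Chosen after \<open>M\<close>: \<open>exp (- B)\<close> makes the logarithm
      large, and the other bound keeps all scales at most \<open>1 / 2\<close> and forces
      \<open>s > b0\<close>.\<close>
    define \<delta> where "\<delta> = min (exp (- B)) (min (1 / 2) (1 - b0\<^sup>2) / 2 ^ M)"
    have "b0\<^sup>2 < 1" using b0 by (simp add: power_less_one_iff)
    then have \<delta>: "0 < \<delta>" by (simp add: \<delta>_def)
    have "((\<lambda>r::real. 1 - r\<^sup>2) \<longlongrightarrow> 1 - 1\<^sup>2) (at_left 1)" by (intro tendsto_intros)
    then have "eventually (\<lambda>r::real. 1 - r\<^sup>2 < \<delta>) (at_left 1)"
      using \<delta> by (intro order_tendstoD) auto
    then obtain a where a: "a < 1" "\<And>r::real. a < r \<Longrightarrow> r < 1 \<Longrightarrow> 1 - r\<^sup>2 < \<delta>"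
      unfolding eventually_at_left_field by blast
    obtain r f where rf: "max a 0 < r" "r < 1" "rho_H_r r f < c"
      using rho_H_less_imp_frequently[OF c(1), of "max a 0"] a(1) by auto
    define x where "x = 1 - r\<^sup>2"
    have x: "0 < x" "x < \<delta>" using a rf by (auto simp: x_def power_less_one_iff)
    have "2 ^ M * x < min (1 / 2) (1 - b0\<^sup>2)"
      using x(2) by (simp add: \<delta>_def pos_less_divide_eq mult.commute)
    then have Mx: "2 ^ M * x \<le> 1 / 2" "b0\<^sup>2 < 1 - 2 ^ M * x" by auto
    have "B < ln (1 / x)"
    proof -
      have "ln x < ln (exp (- B))" using x by (intro ln_less_cancel_iff[THEN iffD2]) (auto simp: \<delta>_def)
      then show ?thesis using x by (simp add: ln_div)
    qed
    then have large: "C * ln (1 / x) \<le> c' * (ln (1 / x) - real M * ln 2)"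
      using C by (simp add: B_def pos_divide_less_eq algebra_simps del: ln_div)
    have r: "0 < r" and c'0: "0 \<le> c'" using rf cc c0 by auto
    have budget: "(1 + \<eta>) * c + (1 + 1 / \<eta>) * (514 * (c + 1) / real M) \<le> C"
      unfolding \<eta> by (simp add: C_def q_def K_def)
    obtain s g where s: "0 < s" "s < 1" "1 - 2 ^ M * x \<le> s\<^sup>2" and g: "rho_H_star_r s g \<le> c'"
      using rho_H_star_r_near[OF r rf(2) less_imp_le[OF rf(3)] \<eta>0 M0 Mx(1)[unfolded x_def] budget
          large[unfolded x_def] c'0] unfolding x_def by blast
    have "b0\<^sup>2 < s\<^sup>2" using Mx s by linarith
    then have "b0 < s" by (rule power2_less_imp_less) (use s(1) in simp)
    then have "b < s" using b0 by linarith
    then show False using b(2)[of s g] s g by linarith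
  qed
qed

end
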